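(* Let $m,n\geq 2$ and $c_{\mathrm{small}}\geq 0$ be integers, and let $T$ be a tournament that contains neither $A_m$ nor $D_n$, such that every subtournament $T'$ of $T$ with $\overrightarrow{\omega}(T')\geq c_{\mathrm{small}}$ contains a copy of $A_{m-1}$ and a copy of $D_{n-1}$. Let $c,a$ be nonnegative integers with $c\geq 2\cdot m!\cdot a+c_{\mathrm{small}}$, and let $(Q_1,\dots,Q_r)$ be a $(c,a)$-near-bag-chain in $T$. Then $\overrightarrow{\omega}\big(\bigcup_{i=1}^r Q_i\big)\leq 4mc$.
   Context: A tournament is a finite directed graph with exactly one arc between each pair of distinct vertices; $N^+(v)$, $N^-(v)$ denote out- and in-neighbourhoods. For a total ordering $<$ of $V(T)$, the backedge graph $B(T,<)$ is the graph on $V(T)$ with an edge $uv$ for every pair $u<v$ with $vu \in A(T)$; $\overrightarrow{\omega}(T)=\min_<\omega(B(T,<))$ over all total orderings, and for $X\subseteq V(T)$, $\overrightarrow{\omega}(X)=\overrightarrow{\omega}(T[X])$. A tournament contains (a copy of) $H$ if some induced subtournament is isomorphic to $H$. For disjoint vertex sets $X,Y$, $X\Rightarrow Y$ means $xy$ is an arc for all $x\in X,y\in Y$. The tournament $A_1$ is a single vertex; for $k\ge 2$, $A_k$ consists of vertex-disjoint tournaments $T_1,\dots,T_{k-1}$, each isomorphic to $A_{k-1}$, and further vertices $v_1,\dots,v_k$, with: $A_k[V(T_i)]=T_i$; $v_j\Rightarrow v_i$ whenever $i<j$; $V(T_i)\Rightarrow V(T_j)$ whenever $i<j$; $v_i\Rightarrow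 V(T_j)$ whenever $i\le j$; and $V(T_j)\Rightarrow v_i$ whenever $i>j$. The tournament $D_1$ is a single vertex, and $D_k$ is obtained from two disjoint copies $T_1,T_2$ of $D_{k-1}$ and one further vertex $w$ with $V(T_1)\Rightarrow V(T_2)$, $V(T_2)\Rightarrow w$, $w \Rightarrow V(T_1)$. A $(c,a)$-near-bag-chain in $T$ is a sequence $(Q_1,\dots,Q_r)$ of pairwise disjoint subsets of $V(T)$ such that for all $i\in\{1,\dots,r\}$: $\overrightarrow{\omega}(Q_i)\le c$; for all $v\in Q_i$, $\overrightarrow{\omega}(N^-(v)\cap\bigcup_{j>i}Q_j)\le a$; and for all $v\in Q_i$, $\overrightarrow{\omega}(N^+(v)\cap\bigcup_{j<i}Q_j)\le a$. *)

theory Defs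
  imports
    "Graph_Theory.Graph_Theory"
    "HOL-Library.Ramsey"
    "HOL-Library.Disjoint_Sets"
begin

locale tournament = digraph T for T :: "('a, 'b) pre_digraph" +
  assumes one_arc: "\<lbrakk>u \<in> verts T; v \<in> verts T; u \<noteq> v\<rbrakk> \<Longrightarrow> u \<rightarrow>\<^bsub>T\<^esub> v \<longleftrightarrow> \<not> v \<rightarrow>\<^bsub>T\<^esub> u"

definition out_nbhd :: "('a, 'b) pre_digraph \<Rightarrow> 'a \<Rightarrow> 'a set" where
  "out_nbhd T v = {u. v \<rightarrow>\<^bsub>T\<^esub> u}"

definition in_nbhd :: "('a, 'b) pre_digraph \<Rightarrow> 'a \<Rightarrow> 'a set" where
  "in_nbhd T v = {u. u \<rightarrow>\<^bsub>T\<^esub> v}"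

definition clique_number :: "'a set \<Rightarrow> 'a set set \<Rightarrow> nat" where
  "clique_number V E = Max {card K | K. K \<subseteq> V \<and> clique K E}"

text \<open>
  Edge set of the backedge graph of a tournament with respect to a total ordering of its
  vertices, given as a reflexive linear order \<open>r\<close>.
\<close>

definition backedges :: "('a, 'b) pre_digraph \<Rightarrow> 'a rel \<Rightarrow> 'a set set" where
  "backedges T r = {{u, v} | u v. (u, v) \<in> r \<and> u \<noteq> v \<and> v \<rightarrow>\<^bsub>T\<^esub> u}"

text \<open>The minimum below ranges over a finite nonempty set whenever \<open>verts T\<close> is finite.\<close>

definition dir_clique_number :: "('a, 'b) pre_digraph \<Rightarrow> nat" where
  "dir_clique_number T =
    Min {clique_number (verts T) (backedges T r) | r. linear_order_on (verts T) r}"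

definition contains_copy :: "('a, 'b) pre_digraph \<Rightarrow> ('c, 'd) pre_digraph \<Rightarrow> bool" where
  "contains_copy T H \<longleftrightarrow> (\<exists>X \<subseteq> verts T. digraph_iso (T \<restriction> X) H)"

text \<open>
  Vertices of the recursively built tournaments: \<open>Copy j x\<close> is the vertex \<open>x\<close> of the \<open>j\<close>-th copy of
  the preceding tournament, and \<open>New i\<close> is the \<open>i\<close>-th further vertex. The recursions start from the
  null tournament at index 0, so that index 1 yields a single vertex.
\<close>

datatype vertex = New nat | Copy nat vertex

primrec A_pair :: "nat \<Rightarrow> vertex pair_pre_digraph" where
  "A_pair 0 = \<lparr>pverts = {}, parcs = {}\<rparr>"
| "A_pair (Suc k) = \<lparr>
    pverts =
      {New i | i. i \<in> {1..Suc k}} \<union>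
      {Copy j x | j x. j \<in> {1..k} \<and> x \<in> pverts (A_pair k)},
    parcs =
      {(Copy j x, Copy j y) | j x y. j \<in> {1..k} \<and> (x, y) \<in> parcs (A_pair k)} \<union>
      {(New j, New i) | i j. i \<in> {1..Suc k} \<and> j \<in> {1..Suc k} \<and> i < j} \<union>
      {(Copy i x, Copy j y) | i j x y. i \<in> {1..k} \<and> j \<in> {1..k} \<and> i < j \<and>
         x \<in> pverts (A_pair k) \<and> y \<in> pverts (A_pair k)} \<union>
      {(New i, Copy j x) | i j x. i \<in> {1..Suc k} \<and> j \<in> {1..k} \<and> i \<le> j \<and>
         x \<in> pverts (A_pair k)} \<union>
      {(Copy j x, New i) | i j x. i \<in> {1..Suc k} \<and> j \<in> {1..k} \<and> i > j \<and>
         x \<in> pverts (A_pair k)}\<rparr>"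

definition A_tour :: "nat \<Rightarrow> (vertex, vertex \<times> vertex) pre_digraph" where
  "A_tour k = with_proj (A_pair k)"

primrec D_pair :: "nat \<Rightarrow> vertex pair_pre_digraph" where
  "D_pair 0 = \<lparr>pverts = {}, parcs = {}\<rparr>"
| "D_pair (Suc k) = \<lparr>
    pverts = {New 1} \<union> {Copy j x | j x. j \<in> {1, 2} \<and> x \<in> pverts (D_pair k)},
    parcs =
      {(Copy j x, Copy j y) | j x y. j \<in> {1, 2} \<and> (x, y) \<in> parcs (D_pair k)} \<union>
      {(Copy 1 x, Copy 2 y) | x y. x \<in> pverts (D_pair k) \<and> y \<in> pverts (D_pair k)} \<union>
      {(Copy 2 x, New 1) | x. x \<in> pverts (D_pair k)} \<union>
      {(New 1, Copy 1 x) | x. x \<in> pverts (D_pair k)}\<rparr>"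

definition D_tour :: "nat \<Rightarrow> (vertex, vertex \<times> vertex) pre_digraph" where
  "D_tour k = with_proj (D_pair k)"

lemma A_tour_1: "verts (A_tour 1) = {New 1}" "arcs (A_tour 1) = {}"
  by (auto simp: A_tour_def)

lemma D_tour_1: "verts (D_tour 1) = {New 1}" "arcs (D_tour 1) = {}"
  by (auto simp: D_tour_def)

definition near_bag_chain ::
  "('a, 'b) pre_digraph \<Rightarrow> nat \<Rightarrow> nat \<Rightarrow> nat \<Rightarrow> (nat \<Rightarrow> 'a set) \<Rightarrow> bool" where
  "near_bag_chain T c a r Q \<longleftrightarrow>
    (\<forall>i \<in> {1..r}. Q i \<subseteq> verts T) \<and>
    disjoint_family_on Q {1..r} \<and>
    (\<forall>i \<in> {1..r}.
       dir_clique_number (T \<restriction> Q i) \<le> c \<and>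
       (\<forall>v \<in> Q i. dir_clique_number (T \<restriction> (in_nbhd T v \<inter> (\<Union>j \<in> {i<..r}. Q j))) \<le> a) \<and>
       (\<forall>v \<in> Q i. dir_clique_number (T \<restriction> (out_nbhd T v \<inter> (\<Union>j \<in> {1..<i}. Q j))) \<le> a))"

end

theory Submission
  imports Defs
begin

text \<open>
  Consecutive bags are merged greedily into blocks of clique number at most \<open>2 * c\<close>, all but the
  last of them at least \<open>c\<close>, and the vertices are ordered block by block, optimally inside each block.
  Suppose that a clique of the backedge graph meets \<open>2 * m - 1\<close> blocks. One vertex from every other
  of these blocks gives \<open>v\<^sub>1, \<dots>, v\<^sub>m\<close> with \<open>v\<^sub>j \<Rightarrow> v\<^sub>i\<close> for \<open>i < j\<close>; between
  consecutive ones lies a block of clique number at least \<open>c\<close>, which still contains \<open>A\<^bsub>m-1\<^esub>\<close> after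
  removing the at most \<open>2 * fact m\<close> exceptional neighbourhoods of the other vertices. This yields
  \<open>A\<^sub>m\<close>. So every clique meets at most \<open>2 * m - 2\<close> blocks, each in at most \<open>2 * c\<close> vertices.
\<close>

section \<open>Backedge cliques and the directed clique number of vertex subsets\<close>

lemma dominates_induce_iff:
  "u \<rightarrow>\<^bsub>T \<restriction> X\<^esub> v \<longleftrightarrow> u \<in> X \<and> v \<in> X \<and> u \<rightarrow>\<^bsub>T\<^esub> v"
  by (auto simp: arcs_ends_def arc_to_ends_def)

text \<open>Cliques of the backedge graph, phrased by \<open>T\<close> and \<open>r\<close> on pairs
  inside \<open>K\<close> only. The ambient vertex set does not occur, so the notion is stable under
  restricting \<open>T\<close> or \<open>r\<close> to a set containing \<open>K\<close>.\<close>

definition back_clique :: "('a, 'b) pre_digraph \<Rightarrow> 'a rel \<Rightarrow> 'a set \<Rightarrow> bool" where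
  "back_clique T r K \<longleftrightarrow> (\<forall>u\<in>K. \<forall>v\<in>K. u \<noteq> v \<longrightarrow> (u, v) \<in> r \<longrightarrow> v \<rightarrow>\<^bsub>T\<^esub> u)"

text \<open>Backedges are unordered pairs: antisymmetry recovers the orientation from an edge, and
  totality guarantees that every pair in \<open>K\<close> is oriented.\<close>

lemma clique_backedges_iff:
  assumes r: "linear_order_on X r" and K: "K \<subseteq> X"
  shows "clique K (backedges (T \<restriction> X) r) \<longleftrightarrow> back_clique T r K"
proof -
  have tot: "(u, v) \<in> r \<or> (v, u) \<in> r" if "u \<in> X" "v \<in> X" "u \<noteq> v" for u v
    using r that by (auto simp: order_on_defs total_on_def)
  have anti: "u = v" if "(u, v) \<in> r" "(v, u) \<in> r" for u v
    using r that by (auto simp: order_on_defs dest: antisymD)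
  have edge: "{u, v} \<in> backedges (T \<restriction> X) r \<longleftrightarrow>
      ((u, v) \<in> r \<and> v \<rightarrow>\<^bsub>T\<^esub> u) \<or> ((v, u) \<in> r \<and> u \<rightarrow>\<^bsub>T\<^esub> v)"
    if "u \<in> X" "v \<in> X" "u \<noteq> v" for u v
    unfolding backedges_def dominates_induce_iff using that by (auto simp: doubleton_eq_iff)
  show ?thesis
  proof
    assume c: "clique K (backedges (T \<restriction> X) r)"
    show "back_clique T r K"
      unfolding back_clique_def
    proof (intro ballI impI)
      fix u v assume uv: "u \<in> K" "v \<in> K" "u \<noteq> v" "(u, v) \<in> r"
      then have "{u, v} \<in> backedges (T \<restriction> X) r" using c by (auto simp: clique_def)
      then show "v \<rightarrow>\<^bsub>T\<^esub> u" using edge[of u v] uv K anti by blast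
    qed
  next
    assume b: "back_clique T r K"
    show "clique K (backedges (T \<restriction> X) r)"
      unfolding clique_def
    proof (intro ballI impI)
      fix u v assume uv: "u \<in> K" "v \<in> K" "u \<noteq> v"
      with K have "u \<in> X" "v \<in> X" by auto
      then show "{u, v} \<in> backedges (T \<restriction> X) r"
        using edge[of u v] tot[of u v] uv b unfolding back_clique_def by metis
    qed
  qed
qed

lemma clique_number_le_iff:
  assumes "finite X" "linear_order_on X r"
  shows "clique_number X (backedges (T \<restriction> X) r) \<le> k \<longleftrightarrow>
    (\<forall>K \<subseteq> X. back_clique T r K \<longrightarrow> card K \<le> k)"
proof -
  let ?S = "{card K | K. K \<subseteq> X \<and> clique K (backedges (T \<restriction> X) r)}"
  have "?S \<subseteq> card ` Pow X" by auto
  then have "finite ?S" using assms(1) by (meson finite_Pow_iff finite_imageI finite_subset)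
  moreover have "?S \<noteq> {}"
    by (auto simp: clique_def intro!: exI[of _ "{}"])
  ultimately show ?thesis
    unfolding clique_number_def using clique_backedges_iff[OF assms(2), of _ T]
    by (subst Max_le_iff) auto
qed

text \<open>This replaces the minimum of maxima from here on: one order proves an upper bound, and
  taking \<open>k\<close> to be the value itself yields an optimal order. The minimum is attained
  because a well-order exists and there are finitely many relations on \<open>X\<close>.\<close>

lemma dir_clique_number_le_iff:
  assumes "finite X"
  shows "dir_clique_number (T \<restriction> X) \<le> k \<longleftrightarrow>
    (\<exists>r. linear_order_on X r \<and> (\<forall>K \<subseteq> X. back_clique T r K \<longrightarrow> card K \<le> k))"
proof -
  let ?S = "{clique_number X (backedges (T \<restriction> X) r) | r. linear_order_on X r}"
  have "?S \<subseteq> (\<lambda>r. clique_number X (backedges (T \<restriction> X) r)) ` Pow (X \<times> X)"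
    by (auto simp: order_on_defs)
  then have "finite ?S" using assms by (meson finite_Pow_iff finite_SigmaI finite_imageI finite_subset)
  moreover obtain r where "well_order_on X r" using well_order_on by blast
  then have "?S \<noteq> {}" by (auto simp: well_order_on_def)
  ultimately have "Min ?S \<le> k \<longleftrightarrow> (\<exists>s \<in> ?S. s \<le> k)" by (rule Min_le_iff)
  then show ?thesis
    unfolding dir_clique_number_def using clique_number_le_iff[OF assms] by auto
qed

lemma linear_order_on_restrict:
  assumes "linear_order_on X r" "Y \<subseteq> X"
  shows "linear_order_on Y (r \<inter> Y \<times> Y)"
  using assms unfolding order_on_defs refl_on_def total_on_def antisym_def trans_def by blast

text \<open>An optimal order of \<open>X\<close>, restricted to \<open>Y\<close>, creates no new
  cliques.\<close>

lemma dir_clique_number_mono: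
  assumes "finite X" "Y \<subseteq> X"
  shows "dir_clique_number (T \<restriction> Y) \<le> dir_clique_number (T \<restriction> X)"
proof -
  obtain r where r: "linear_order_on X r"
    "\<And>K. K \<subseteq> X \<Longrightarrow> back_clique T r K \<Longrightarrow> card K \<le> dir_clique_number (T \<restriction> X)"
    using dir_clique_number_le_iff[OF assms(1), of T "dir_clique_number (T \<restriction> X)"] by blast
  have "card K \<le> dir_clique_number (T \<restriction> X)"
    if K: "K \<subseteq> Y" "back_clique T (r \<inter> Y \<times> Y) K" for K
  proof (rule r(2))
    show "K \<subseteq> X" using K(1) assms(2) by blast
    show "back_clique T r K" using K unfolding back_clique_def by blast
  qed
  with linear_order_on_restrict[OF r(1) assms(2)] assms show ?thesis
    by (subst dir_clique_number_le_iff) (auto intro: finite_subset)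
qed

lemma dir_clique_number_empty: "dir_clique_number (T \<restriction> {}) = 0"
proof -
  have "dir_clique_number (T \<restriction> {}) \<le> 0"
    by (subst dir_clique_number_le_iff) (auto intro!: exI[of _ "{}"])
  then show ?thesis by simp
qed

section \<open>Level-by-level orders and subadditivity\<close>

text \<open>In the main application \<open>h\<close> is the block index of a vertex and
  \<open>R i\<close> an optimal order of block \<open>i\<close>.\<close>

definition lex_rel :: "'a set \<Rightarrow> ('a \<Rightarrow> nat) \<Rightarrow> (nat \<Rightarrow> 'a rel) \<Rightarrow> 'a rel" where
  "lex_rel X h R = {(x, y). x \<in> X \<and> y \<in> X \<and> (h x < h y \<or> h x = h y \<and> (x, y) \<in> R (h x))}"

lemma linear_order_on_lex_rel:
  assumes "\<And>i. linear_order_on {x \<in> X. h x = i} (R i)"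
  shows "linear_order_on X (lex_rel X h R)"
proof -
  have refl: "(x, x) \<in> R (h x)" if "x \<in> X" for x
    using assms[of "h x"] that by (auto simp: order_on_defs refl_on_def)
  have anti: "x = y" if "(x, y) \<in> R i" "(y, x) \<in> R i" for x y i
    using assms[of i] that by (auto simp: order_on_defs dest: antisymD)
  have tr: "(x, z) \<in> R i" if "(x, y) \<in> R i" "(y, z) \<in> R i" for x y z i
    using assms[of i] that by (auto simp: order_on_defs dest: transD)
  have tot: "(x, y) \<in> R (h x) \<or> (y, x) \<in> R (h x)" if "x \<in> X" "y \<in> X" "h x = h y" "x \<noteq> y" for x y
    using assms[of "h x"] that by (auto simp: order_on_defs total_on_def)
  show ?thesis
    unfolding order_on_defs
  proof (intro conjI)
    show "lex_rel X h R \<subseteq> X \<times> X" by (auto simp: lex_rel_def)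
    show "refl_on X (lex_rel X h R)" using refl by (auto simp: lex_rel_def refl_on_def)
    show "trans (lex_rel X h R)" using tr unfolding trans_def lex_rel_def by auto
    show "antisym (lex_rel X h R)" using anti unfolding antisym_def lex_rel_def by auto
    show "total_on X (lex_rel X h R)"
    proof (rule total_onI)
      fix x y assume "x \<in> X" "y \<in> X" "x \<noteq> y"
      then show "(x, y) \<in> lex_rel X h R \<or> (y, x) \<in> lex_rel X h R"
        using tot[of x y] by (cases "h x" "h y" rule: linorder_cases) (simp_all add: lex_rel_def)
    qed
  qed
qed

text \<open>Each \<open>R i\<close> is chosen to witness the bound \<open>f i\<close>. Inside level
  \<open>i\<close> the lexicographic order agrees with \<open>R i\<close>, so a clique meets that
  level in a clique of \<open>R i\<close>.\<close>

lemma exists_lex_rel: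
  assumes "finite X" "\<And>i. dir_clique_number (T \<restriction> {x \<in> X. h x = i}) \<le> f i"
  obtains R where "linear_order_on X (lex_rel X h R)"
    "\<And>K i. K \<subseteq> X \<Longrightarrow> back_clique T (lex_rel X h R) K \<Longrightarrow> card {x \<in> K. h x = i} \<le> f i"
proof -
  have "\<forall>i. \<exists>r. linear_order_on {x \<in> X. h x = i} r \<and>
      (\<forall>K \<subseteq> {x \<in> X. h x = i}. back_clique T r K \<longrightarrow> card K \<le> f i)"
    using assms by (subst dir_clique_number_le_iff[symmetric]) auto
  then obtain R where R: "\<And>i. linear_order_on {x \<in> X. h x = i} (R i)"
    "\<And>i K. K \<subseteq> {x \<in> X. h x = i} \<Longrightarrow> back_clique T (R i) K \<Longrightarrow> card K \<le> f i"
    by metis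
  show thesis
  proof (rule that[OF linear_order_on_lex_rel[OF R(1)]])
    fix K i assume K: "K \<subseteq> X" "back_clique T (lex_rel X h R) K"
    have "back_clique T (R i) {x \<in> K. h x = i}"
      unfolding back_clique_def
    proof (intro ballI impI)
      fix u v assume uv: "u \<in> {x \<in> K. h x = i}" "v \<in> {x \<in> K. h x = i}" "u \<noteq> v" "(u, v) \<in> R i"
      then have "(u, v) \<in> lex_rel X h R" using K(1) by (auto simp: lex_rel_def)
      then show "v \<rightarrow>\<^bsub>T\<^esub> u" using K(2) uv by (simp add: back_clique_def)
    qed
    then show "card {x \<in> K. h x = i} \<le> f i" using K(1) by (intro R(2)) auto
  qed
qed

text \<open>Place \<open>X\<close> before \<open>Y - X\<close>: a clique splits into its two levels.
  All levels above 1 are empty.\<close>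

lemma dir_clique_number_Un_le:
  assumes "finite X" "finite Y"
  shows "dir_clique_number (T \<restriction> (X \<union> Y)) \<le> dir_clique_number (T \<restriction> X) + dir_clique_number (T \<restriction> Y)"
proof -
  define h where "h x = (if x \<in> X then 0 else 1 :: nat)" for x
  define f where "f i = (if i = 0 then dir_clique_number (T \<restriction> X) else dir_clique_number (T \<restriction> Y))"
    for i :: nat
  have "dir_clique_number (T \<restriction> {x \<in> X \<union> Y. h x = i}) \<le> f i" for i
    using assms by (auto simp: f_def h_def intro!: dir_clique_number_mono)
  then obtain R where R: "linear_order_on (X \<union> Y) (lex_rel (X \<union> Y) h R)"
    "\<And>K i. K \<subseteq> X \<union> Y \<Longrightarrow> back_clique T (lex_rel (X \<union> Y) h R) K \<Longrightarrow> card {x \<in> K. h x = i} \<le> f i"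
    using exists_lex_rel[of "X \<union> Y" T h f] assms by auto
  have "card K \<le> f 0 + f 1" if K: "K \<subseteq> X \<union> Y" "back_clique T (lex_rel (X \<union> Y) h R) K" for K
  proof -
    have "K = {x \<in> K. h x = 0} \<union> {x \<in> K. h x = 1}" by (auto simp: h_def)
    then have "card K \<le> card {x \<in> K. h x = 0} + card {x \<in> K. h x = 1}"
      by (metis card_Un_le)
    with R(2)[OF K, of 0] R(2)[OF K, of 1] show ?thesis by simp
  qed
  then have "dir_clique_number (T \<restriction> (X \<union> Y)) \<le> f 0 + f 1"
    using assms R(1) by (subst dir_clique_number_le_iff) auto
  then show ?thesis by (simp add: f_def)
qed

text \<open>By subadditivity, each removal of a \<open>B i\<close> lowers the clique number by at
  most \<open>a\<close>.\<close>

lemma dir_clique_number_Diff_UN: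
  assumes "finite I" "finite X" "\<And>i. i \<in> I \<Longrightarrow> dir_clique_number (T \<restriction> (B i \<inter> X)) \<le> a"
  shows "dir_clique_number (T \<restriction> X) \<le> dir_clique_number (T \<restriction> (X - (\<Union>i\<in>I. B i))) + card I * a"
  using assms
proof (induction I rule: finite_induct)
  case (insert i I)
  let ?Z = "X - (\<Union>i\<in>I. B i)"
  have "dir_clique_number (T \<restriction> ?Z) \<le> dir_clique_number (T \<restriction> ((?Z - B i) \<union> (B i \<inter> X)))"
    using insert by (intro dir_clique_number_mono) auto
  also have "\<dots> \<le> dir_clique_number (T \<restriction> (?Z - B i)) + dir_clique_number (T \<restriction> (B i \<inter> X))"
    using insert by (intro dir_clique_number_Un_le) auto
  also have "\<dots> \<le> dir_clique_number (T \<restriction> (?Z - B i)) + a"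
    using insert by simp
  also have "?Z - B i = X - (\<Union>i\<in>insert i I. B i)" by auto
  finally have "dir_clique_number (T \<restriction> ?Z) \<le> dir_clique_number (T \<restriction> (X - (\<Union>i\<in>insert i I. B i))) + a" .
  moreover have "dir_clique_number (T \<restriction> X) \<le> dir_clique_number (T \<restriction> ?Z) + card I * a"
    using insert by simp
  ultimately show ?case using insert by simp
qed simp

section \<open>Copies as arc-preserving maps\<close>

text \<open>The isomorphism runs from \<open>T \<restriction> X\<close> to the pattern, so the map
  wanted is its inverse. Since \<open>with_proj\<close> has \<open>fst\<close> and
  \<open>snd\<close> as tail and head, a pair \<open>(x, y)\<close> comes from an arc whose ends are
  mapped to \<open>x\<close> and \<open>y\<close>.\<close>

lemma contains_copyD:
  assumes "contains_copy T (with_proj P)"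
  obtains \<phi> where "\<phi> ` pverts P \<subseteq> verts T" "\<And>x y. (x, y) \<in> parcs P \<Longrightarrow> \<phi> x \<rightarrow>\<^bsub>T\<^esub> \<phi> y"
proof -
  obtain X f where X: "X \<subseteq> verts T" and f: "pre_digraph.digraph_isomorphism (T \<restriction> X) f"
    and eq: "with_proj P = app_iso f (T \<restriction> X)"
    using assms unfolding contains_copy_def digraph_iso_def by auto
  note f' = f[unfolded pre_digraph.digraph_isomorphism_def]
  have inj: "inj_on (iso_verts f) X" using f' by simp
  define \<phi> where "\<phi> = the_inv_into X (iso_verts f)"
  have P: "pverts P = iso_verts f ` X" "parcs P = iso_arcs f ` arcs (T \<restriction> X)"
    "iso_tail f = fst" "iso_head f = snd"
    using eq by (simp_all add: app_iso_def with_proj_def)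
  have \<phi>: "\<phi> (iso_verts f x) = x" if "x \<in> X" for x
    using that inj by (simp add: \<phi>_def the_inv_into_f_f)
  show thesis
  proof (rule that)
    show "\<phi> ` pverts P \<subseteq> verts T" using X \<phi> P(1) by auto
    fix x y assume "(x, y) \<in> parcs P"
    then obtain e where e: "e \<in> arcs (T \<restriction> X)" "iso_arcs f e = (x, y)" using P by auto
    with f' P have "iso_verts f (tail T e) = x" "iso_verts f (head T e) = y" by auto
    moreover have "tail T e \<in> X" "head T e \<in> X" using e by auto
    ultimately have "\<phi> x = tail T e" "\<phi> y = head T e" using \<phi> by auto
    then show "\<phi> x \<rightarrow>\<^bsub>T\<^esub> \<phi> y" using e by (auto simp: arcs_ends_def arc_to_ends_def)
  qed
qed

text \<open>For a total pattern, preserving arcs suffices: identifying two vertices would create a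
  loop in \<open>T\<close>, and a pattern arc in the wrong direction would create a pair of opposite
  arcs.\<close>

lemma (in tournament) contains_copyI:
  assumes parcs: "parcs P \<subseteq> pverts P \<times> pverts P"
    and total: "total_on (pverts P) (parcs P)"
    and \<phi>_verts: "\<phi> ` pverts P \<subseteq> verts T"
    and \<phi>_arcs: "\<And>x y. (x, y) \<in> parcs P \<Longrightarrow> \<phi> x \<rightarrow>\<^bsub>T\<^esub> \<phi> y"
  shows "contains_copy T (with_proj P)"
proof -
  have irr: "\<not> x \<rightarrow>\<^bsub>T\<^esub> x" for x using adj_not_same by blast
  have inj: "inj_on \<phi> (pverts P)"
    using total \<phi>_arcs irr unfolding inj_on_def total_on_def by metis
  define X where "X = \<phi> ` pverts P"
  define g where "g = the_inv_into (pverts P) \<phi>"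
  have g: "g (\<phi> x) = x" if "x \<in> pverts P" for x
    using that inj by (simp add: g_def the_inv_into_f_f)
  \<comment> \<open>The isomorphism starts at \<open>T \<restriction> X\<close>, hence the use of
    the inverse \<open>g\<close>. It is injective on arcs because \<open>T\<close> has no parallel
    arcs.\<close>
  define f where "f = \<lparr>iso_verts = g, iso_arcs = (\<lambda>e. (g (tail T e), g (head T e))),
    iso_head = snd, iso_tail = fst\<rparr>"
  have X: "X \<subseteq> verts T" using \<phi>_verts by (simp add: X_def)
  have injg: "inj_on g X" using g by (auto simp: X_def inj_on_def)
  have arcE: "(g (tail T e), g (head T e)) \<in> parcs P" if e: "e \<in> arcs (T \<restriction> X)" for e
  proof -
    obtain x y where xy: "x \<in> pverts P" "y \<in> pverts P" "tail T e = \<phi> x" "head T e = \<phi> y"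
      using e by (auto simp: X_def)
    have "(tail T e, head T e) \<in> arcs_ends T" using e by (auto simp: arcs_ends_def arc_to_ends_def)
    then have dom: "\<phi> x \<rightarrow>\<^bsub>T\<^esub> \<phi> y" using xy by simp
    have "\<phi> x \<in> verts T" "\<phi> y \<in> verts T" using \<phi>_verts xy by auto
    with dom have "x \<noteq> y" "\<not> \<phi> y \<rightarrow>\<^bsub>T\<^esub> \<phi> x"
      using irr[of "\<phi> x"] one_arc[of "\<phi> x" "\<phi> y"] by metis+
    then have "(x, y) \<in> parcs P" using total \<phi>_arcs xy unfolding total_on_def by blast
    then show ?thesis using xy g by simp
  qed
  have "pre_digraph.digraph_isomorphism (T \<restriction> X) f"
    unfolding pre_digraph.digraph_isomorphism_def
  proof (intro conjI)
    show "wf_digraph (T \<restriction> X)" by (rule wellformed_induce_subgraph)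
    show "inj_on (iso_verts f) (verts (T \<restriction> X))" using injg by (simp add: f_def)
    show "inj_on (iso_arcs f) (arcs (T \<restriction> X))"
    proof (rule inj_onI)
      fix e e' assume e: "e \<in> arcs (T \<restriction> X)" "e' \<in> arcs (T \<restriction> X)" "iso_arcs f e = iso_arcs f e'"
      then have "tail T e = tail T e'" "head T e = head T e'"
        using injg by (auto simp: f_def dest: inj_onD)
      then show "e = e'" using e no_multi_arcs by (auto simp: arc_to_ends_def)
    qed
  qed (auto simp: f_def)
  moreover have "with_proj P = app_iso f (T \<restriction> X)"
  proof -
    have "g ` X = pverts P" using g by (force simp: X_def)
    moreover have "iso_arcs f ` arcs (T \<restriction> X) = parcs P"
    proof
      show "iso_arcs f ` arcs (T \<restriction> X) \<subseteq> parcs P" using arcE by (auto simp: f_def)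
      show "parcs P \<subseteq> iso_arcs f ` arcs (T \<restriction> X)"
      proof clarify
        fix x y assume xy: "(x, y) \<in> parcs P"
        then obtain e where e: "e \<in> arcs T" "tail T e = \<phi> x" "head T e = \<phi> y"
          using \<phi>_arcs by (force simp: arcs_ends_def arc_to_ends_def)
        moreover have "x \<in> pverts P" "y \<in> pverts P" using xy parcs by auto
        ultimately show "(x, y) \<in> iso_arcs f ` arcs (T \<restriction> X)"
          using g by (intro image_eqI[of _ _ e]) (auto simp: f_def X_def)
      qed
    qed
    ultimately show ?thesis by (simp add: app_iso_def with_proj_def f_def)
  qed
  ultimately show ?thesis using X unfolding contains_copy_def digraph_iso_def by blast
qed

section \<open>The tournaments \<open>A_pair k\<close>: totality, size and greedy embedding\<close>

lemma A_pair_parcs: "parcs (A_pair k) \<subseteq> pverts (A_pair k) \<times> pverts (A_pair k)"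
  by (induction k) auto

lemma A_pair_total: "total_on (pverts (A_pair k)) (parcs (A_pair k))"
proof (induction k)
  case (Suc k)
  show ?case
    unfolding total_on_def
  proof (intro ballI impI)
    fix x y assume xy: "x \<in> pverts (A_pair (Suc k))" "y \<in> pverts (A_pair (Suc k))" "x \<noteq> y"
    show "(x, y) \<in> parcs (A_pair (Suc k)) \<or> (y, x) \<in> parcs (A_pair (Suc k))"
    proof (cases x)
      case x: (New i)
      show ?thesis
      proof (cases y)
        case (New j) then show ?thesis using xy x by auto
      next
        case (Copy j z) then show ?thesis using xy x by auto
      qed
    next
      case x: (Copy i u)
      show ?thesis
      proof (cases y)
        case (New j) then show ?thesis using xy x by auto
      next
        case y: (Copy j z)
        then have "u \<noteq> z \<or> i < j \<or> j < i" using xy x by auto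
        then show ?thesis using xy x y Suc unfolding total_on_def by auto
      qed
    qed
  qed
qed simp

lemma finite_A_pair: "finite (pverts (A_pair k))"
proof (induction k)
  case (Suc k)
  have "pverts (A_pair (Suc k)) =
      New ` {1..Suc k} \<union> case_prod Copy ` ({1..k} \<times> pverts (A_pair k))" by auto
  then show ?case using Suc by simp
qed simp

text \<open>The right-hand side has the shape of the constraint count in the greedy embedding,
  \<open>Suc k + l * card V\<close> with \<open>l < k\<close>, where \<open>V\<close> is the vertex
  set of \<open>A_pair k\<close>.\<close>

lemma card_A_pair_Suc:
  "card (pverts (A_pair (Suc k))) = Suc k + k * card (pverts (A_pair k))"
proof -
  have "pverts (A_pair (Suc k)) =
      New ` {1..Suc k} \<union> case_prod Copy ` ({1..k} \<times> pverts (A_pair k))" by auto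
  moreover have "card (New ` {1..Suc k} \<union> case_prod Copy ` ({1..k} \<times> pverts (A_pair k))) =
      card (New ` {1..Suc k}) + card (case_prod Copy ` ({1..k} \<times> pverts (A_pair k)))"
    using finite_A_pair by (intro card_Un_disjoint) auto
  ultimately show ?thesis by (simp add: card_image inj_on_def card_cartesian_product)
qed

text \<open>Source of the constant \<open>2 * fact m\<close>. Strictness carries the induction: with
  \<open>N\<close> the size at \<open>k\<close>, it gives \<open>N + 1 \<le> 2 * fact k\<close>,
  which absorbs \<open>k\<close> of the \<open>Suc k\<close> further vertices.\<close>

lemma card_A_pair_less: "card (pverts (A_pair k)) < 2 * fact k"
proof (induction k)
  case (Suc k)
  have "k * (card (pverts (A_pair k)) + 1) \<le> k * (2 * fact k)"
    using Suc by (intro mult_le_mono) auto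
  then have "card (pverts (A_pair (Suc k))) \<le> 1 + k * (2 * fact k)"
    unfolding card_A_pair_Suc by simp
  also have "\<dots> < 2 * fact k + k * (2 * fact k)"
    using fact_ge_1[of k, where 'a = nat] by linarith
  finally show ?case by (simp add: algebra_simps)
qed simp

text \<open>The copies of \<open>A_pair k\<close> are chosen greedily, from left to right: fewer than \<open>2 * fact (Suc k)\<close>
  vertices constrain the choice inside \<open>W j\<close>, and each of them spoils a part of \<open>W j\<close> of
  clique number at most \<open>a\<close>.\<close>

lemma (in tournament) contains_A_tour_Suc:
  assumes v: "\<And>i. i \<in> {1..Suc k} \<Longrightarrow> v i \<in> verts T"
    and vv: "\<And>i j. \<lbrakk>i \<in> {1..Suc k}; j \<in> {1..Suc k}; i < j\<rbrakk> \<Longrightarrow> v j \<rightarrow>\<^bsub>T\<^esub> v i"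
    and W: "\<And>j. j \<in> {1..k} \<Longrightarrow> W j \<subseteq> verts T"
    and vW: "\<And>i j. \<lbrakk>i \<in> {1..Suc k}; j \<in> {1..k}; i \<le> j\<rbrakk> \<Longrightarrow>
      dir_clique_number (T \<restriction> (in_nbhd T (v i) \<inter> W j)) \<le> a \<and> v i \<notin> W j"
    and Wv: "\<And>i j. \<lbrakk>i \<in> {1..Suc k}; j \<in> {1..k}; j < i\<rbrakk> \<Longrightarrow>
      dir_clique_number (T \<restriction> (out_nbhd T (v i) \<inter> W j)) \<le> a \<and> v i \<notin> W j"
    and WW: "\<And>i j x. \<lbrakk>i \<in> {1..k}; j \<in> {1..k}; i < j; x \<in> W i\<rbrakk> \<Longrightarrow>
      dir_clique_number (T \<restriction> (in_nbhd T x \<inter> W j)) \<le> a \<and> x \<notin> W j"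
    and large: "\<And>j. j \<in> {1..k} \<Longrightarrow> 2 * fact (Suc k) * a + s \<le> dir_clique_number (T \<restriction> W j)"
    and copy: "\<And>X. \<lbrakk>X \<subseteq> verts T; s \<le> dir_clique_number (T \<restriction> X)\<rbrakk> \<Longrightarrow> contains_copy (T \<restriction> X) (A_tour k)"
  shows "contains_copy T (A_tour (Suc k))"
proof -
  let ?V = "pverts (A_pair k)" and ?E = "parcs (A_pair k)"
  have flip: "x \<rightarrow>\<^bsub>T\<^esub> y" if "x \<in> verts T" "y \<in> verts T" "x \<noteq> y" "\<not> y \<rightarrow>\<^bsub>T\<^esub> x" for x y
    using one_arc that by blast
  \<comment> \<open>Invariant of the greedy choice: the first \<open>l\<close> copies are placed,
    correctly related to each other and already to all the \<open>v i\<close>.\<close>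
  define good where "good l \<phi> \<longleftrightarrow>
      (\<forall>j\<in>{1..l}. \<phi> j ` ?V \<subseteq> W j \<and> (\<forall>(x, y)\<in>?E. \<phi> j x \<rightarrow>\<^bsub>T\<^esub> \<phi> j y) \<and>
        (\<forall>x\<in>?V. \<forall>i\<in>{1..Suc k}. (i \<le> j \<longrightarrow> v i \<rightarrow>\<^bsub>T\<^esub> \<phi> j x) \<and> (j < i \<longrightarrow> \<phi> j x \<rightarrow>\<^bsub>T\<^esub> v i)) \<and>
        (\<forall>i\<in>{1..<j}. \<forall>x\<in>?V. \<forall>y\<in>?V. \<phi> i x \<rightarrow>\<^bsub>T\<^esub> \<phi> j y))" for l and \<phi> :: "nat \<Rightarrow> vertex \<Rightarrow> 'a"
  have "\<exists>\<phi>. good l \<phi>" if "l \<le> k" for l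
    using that
  proof (induction l)
    case 0
    show ?case by (simp add: good_def)
  next
    case (Suc l)
    then obtain \<phi> where \<phi>: "good l \<phi>" by auto
    let ?j = "Suc l"
    have j: "?j \<in> {1..k}" using Suc by simp
    \<comment> \<open>\<open>B y\<close> collects the vertices whose arc with the vertex coded by
      \<open>y\<close> would point the wrong way. \<open>Inl i\<close> codes \<open>v i\<close>, and
      \<open>Inr (i, x)\<close> codes vertex \<open>x\<close> of the copy placed in
      \<open>W i\<close>.\<close>
    define B where "B y = (case y of Inl i \<Rightarrow> if i \<le> ?j then in_nbhd T (v i) else out_nbhd T (v i)
      | Inr (i, x) \<Rightarrow> in_nbhd T (\<phi> i x))" for y
    define I where "I = {1..Suc k} <+> ({1..l} \<times> ?V)"
    have finI: "finite I" unfolding I_def using finite_A_pair by simp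
    have "card I = Suc k + l * card ?V"
      unfolding I_def using finite_A_pair by (simp add: card_Plus card_cartesian_product)
    \<comment> \<open>At most \<open>k\<close> copies are counted, so the constraining vertices are
      no more than the vertices of \<open>A_pair (Suc k)\<close>.\<close>
    also have "\<dots> \<le> card (pverts (A_pair (Suc k)))"
      unfolding card_A_pair_Suc using Suc.prems by simp
    also have "\<dots> \<le> 2 * fact (Suc k)" using card_A_pair_less by (rule less_imp_le)
    finally have cardI: "card I \<le> 2 * fact (Suc k)" .
    define R where "R = W ?j - (\<Union>y\<in>I. B y)"
    have inW: "\<phi> i x \<in> W i" if "i \<in> {1..l}" "x \<in> ?V" for i x
      using \<phi> that unfolding good_def by blast
    have "dir_clique_number (T \<restriction> (B y \<inter> W ?j)) \<le> a" if "y \<in> I" for y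
      using that unfolding I_def
    proof (elim PlusE)
      fix i assume i: "i \<in> {1..Suc k}" "y = Inl i"
      then show ?thesis using vW[OF i(1) j] Wv[OF i(1) j] by (auto simp: B_def)
    next
      fix z assume z: "z \<in> {1..l} \<times> ?V" "y = Inr z"
      then obtain i x where ix: "z = (i, x)" "i \<in> {1..l}" "x \<in> ?V" by auto
      then show ?thesis using WW[of i ?j "\<phi> i x"] inW[of i x] j z by (auto simp: B_def)
    qed
    moreover have "finite (W ?j)" using W[OF j] by (rule finite_subset) simp
    ultimately have "dir_clique_number (T \<restriction> W ?j) \<le> dir_clique_number (T \<restriction> R) + card I * a"
      unfolding R_def by (intro dir_clique_number_Diff_UN finI)
    moreover have "card I * a \<le> 2 * fact (Suc k) * a" using cardI by (rule mult_right_mono) simp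
    ultimately have "s \<le> dir_clique_number (T \<restriction> R)" using large[OF j] by linarith
    moreover have RV: "R \<subseteq> verts T" using W[OF j] by (auto simp: R_def)
    ultimately have "contains_copy (T \<restriction> R) (A_tour k)" by (intro copy)
    then obtain \<psi> where \<psi>: "\<psi> ` ?V \<subseteq> R" "\<And>x y. (x, y) \<in> ?E \<Longrightarrow> \<psi> x \<rightarrow>\<^bsub>T\<^esub> \<psi> y"
      unfolding A_tour_def by (elim contains_copyD) (auto simp: dominates_induce_iff)
    have RW: "R \<subseteq> W ?j" by (auto simp: R_def)
    have avoid: "x \<notin> B y" if "x \<in> R" "y \<in> I" for x y using that by (auto simp: R_def)
    have Inl_I: "Inl i \<in> I" if "i \<in> {1..Suc k}" for i
      using that unfolding I_def by (rule InlI)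
    have Inr_I: "Inr (i, x) \<in> I" if "i \<in> {1..l}" "x \<in> ?V" for i x
      using that unfolding I_def by (intro InrI SigmaI)
    \<comment> \<open>Outside the sets \<open>B y\<close> no arc points the wrong way. The vertices
      being distinct, as \<open>v i\<close> lies outside \<open>W ?j\<close>, the tournament
      property supplies the required arc; the next two facts follow the same pattern.\<close>
    have 1: "v i \<rightarrow>\<^bsub>T\<^esub> x" if "x \<in> R" "i \<in> {1..Suc k}" "i \<le> ?j" for i x
    proof (rule flip)
      show "\<not> x \<rightarrow>\<^bsub>T\<^esub> v i"
        using avoid[OF that(1) Inl_I[OF that(2)]] that(3) by (simp add: B_def in_nbhd_def)
    qed (use that v vW[of i ?j] RV RW j in auto)
    have 2: "x \<rightarrow>\<^bsub>T\<^esub> v i" if "x \<in> R" "i \<in> {1..Suc k}" "?j < i" for i x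
    proof (rule flip)
      show "\<not> v i \<rightarrow>\<^bsub>T\<^esub> x"
        using avoid[OF that(1) Inl_I[OF that(2)]] that(3) by (simp add: B_def out_nbhd_def)
    qed (use that v Wv[of i ?j] RV RW j in auto)
    have 3: "\<phi> i x \<rightarrow>\<^bsub>T\<^esub> y" if "y \<in> R" "i \<in> {1..l}" "x \<in> ?V" for i x y
    proof (rule flip)
      show "\<not> y \<rightarrow>\<^bsub>T\<^esub> \<phi> i x"
        using avoid[OF that(1) Inr_I[OF that(2,3)]] by (simp add: B_def in_nbhd_def)
      show "\<phi> i x \<in> verts T" using inW[of i x] W[of i] that j by auto
      show "\<phi> i x \<noteq> y" using inW[of i x] WW[of i ?j "\<phi> i x"] that j RW by auto
    qed (use that RV in auto)
    have "good ?j (\<phi>(?j := \<psi>))"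
      unfolding good_def
    proof
      fix j assume jj: "j \<in> {1..?j}"
      show "(\<phi>(?j := \<psi>)) j ` ?V \<subseteq> W j \<and> (\<forall>(x, y)\<in>?E. (\<phi>(?j := \<psi>)) j x \<rightarrow>\<^bsub>T\<^esub> (\<phi>(?j := \<psi>)) j y) \<and>
        (\<forall>x\<in>?V. \<forall>i\<in>{1..Suc k}. (i \<le> j \<longrightarrow> v i \<rightarrow>\<^bsub>T\<^esub> (\<phi>(?j := \<psi>)) j x) \<and>
          (j < i \<longrightarrow> (\<phi>(?j := \<psi>)) j x \<rightarrow>\<^bsub>T\<^esub> v i)) \<and>
        (\<forall>i\<in>{1..<j}. \<forall>x\<in>?V. \<forall>y\<in>?V. (\<phi>(?j := \<psi>)) i x \<rightarrow>\<^bsub>T\<^esub> (\<phi>(?j := \<psi>)) j y)"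
      proof (cases "j = ?j")
        case True
        have "\<psi> x \<in> R" if "x \<in> ?V" for x using \<psi>(1) that by auto
        with True \<psi>(2) RW 1 2 3 show ?thesis by auto
      next
        case False
        then have "j \<in> {1..l}" using jj by auto
        moreover have "(\<phi>(?j := \<psi>)) i = \<phi> i" if "i \<le> j" for i
          using that \<open>j \<in> {1..l}\<close> by auto
        ultimately show ?thesis using \<phi> unfolding good_def by simp
      qed
    qed
    then show ?case by blast
  qed
  then obtain \<phi> where \<phi>: "good k \<phi>" by blast
  define \<Phi> where "\<Phi> x = (case x of New i \<Rightarrow> v i | Copy j x \<Rightarrow> \<phi> j x)" for x
  have \<phi>_inner: "\<phi> j x \<rightarrow>\<^bsub>T\<^esub> \<phi> j y" if "j \<in> {1..k}" "(x, y) \<in> ?E" for j x y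
    using \<phi> that unfolding good_def by blast
  have \<phi>_cross: "\<phi> i x \<rightarrow>\<^bsub>T\<^esub> \<phi> j y" if "i \<in> {1..k}" "j \<in> {1..k}" "i < j" "x \<in> ?V" "y \<in> ?V" for i j x y
    using \<phi> that unfolding good_def by auto
  have v\<phi>: "v i \<rightarrow>\<^bsub>T\<^esub> \<phi> j x" if "i \<in> {1..Suc k}" "j \<in> {1..k}" "i \<le> j" "x \<in> ?V" for i j x
    using \<phi> that unfolding good_def by blast
  have \<phi>v: "\<phi> j x \<rightarrow>\<^bsub>T\<^esub> v i" if "i \<in> {1..Suc k}" "j \<in> {1..k}" "j < i" "x \<in> ?V" for i j x
    using \<phi> that unfolding good_def by blast
  have \<phi>_verts: "\<phi> j x \<in> verts T" if "j \<in> {1..k}" "x \<in> ?V" for j x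
    using \<phi> that W unfolding good_def by blast
  show ?thesis
    unfolding A_tour_def
  proof (rule contains_copyI[where \<phi> = \<Phi>, OF A_pair_parcs A_pair_total])
    show "\<Phi> ` pverts (A_pair (Suc k)) \<subseteq> verts T"
      using v \<phi>_verts by (auto simp: \<Phi>_def)
    fix x y assume "(x, y) \<in> parcs (A_pair (Suc k))"
    \<comment> \<open>The five families of arcs are covered, in order, by
      \<open>\<phi>_inner\<close>, \<open>vv\<close>, \<open>\<phi>_cross\<close>,
      \<open>v\<phi>\<close> and \<open>\<phi>v\<close>.\<close>
    then show "\<Phi> x \<rightarrow>\<^bsub>T\<^esub> \<Phi> y"
      unfolding A_pair.simps pair_pre_digraph.simps Un_iff
      by (elim disjE) (use \<phi>_inner \<phi>_cross v\<phi> \<phi>v vv in \<open>auto simp: \<Phi>_def\<close>)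
  qed
qed

section \<open>Merging consecutive bags into blocks\<close>

text \<open>\<open>g i\<close> is the block receiving bag \<open>i\<close>, and \<open>L\<close> is
  the current block. The next bag joins block \<open>L\<close> while its clique number is below
  \<open>c\<close> and opens block \<open>Suc L\<close> otherwise, so at most \<open>c\<close> is
  added to at most \<open>c\<close>.\<close>

lemma exists_blocks:
  fixes Q :: "nat \<Rightarrow> 'a set"
  assumes "\<And>i. i \<in> {1..r} \<Longrightarrow> finite (Q i) \<and> dir_clique_number (T \<restriction> Q i) \<le> c"
  obtains g L where "mono_on {1..r} g" "\<forall>i\<in>{1..r}. g i \<le> (L :: nat)"
    "\<forall>k. dir_clique_number (T \<restriction> (\<Union>i\<in>{i \<in> {1..r}. g i = k}. Q i)) \<le> 2 * c"
    "\<forall>k<L. c \<le> dir_clique_number (T \<restriction> (\<Union>i\<in>{i \<in> {1..r}. g i = k}. Q i))"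
proof -
  define blk where "blk r g k = (\<Union>i\<in>{i \<in> {1..r}. g i = k}. Q i)" for r and g :: "nat \<Rightarrow> nat" and k
  have "\<exists>g L. mono_on {1..r} g \<and> (\<forall>i\<in>{1..r}. g i \<le> L) \<and>
      (\<forall>k. dir_clique_number (T \<restriction> blk r g k) \<le> 2 * c) \<and>
      (\<forall>k<L. c \<le> dir_clique_number (T \<restriction> blk r g k))"
    using assms
  proof (induction r)
    case 0
    \<comment> \<open>Without bags the current block 0 is empty, and no completed block lies below
      it.\<close>
    show ?case
      by (rule exI[of _ "\<lambda>_. 0"], rule exI[of _ 0])
        (simp add: blk_def dir_clique_number_empty mono_on_def)
  next
    case (Suc r)
    have "finite (Q i) \<and> dir_clique_number (T \<restriction> Q i) \<le> c" if "i \<in> {1..r}" for i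
      using Suc.prems that by simp
    then obtain g L where g: "mono_on {1..r} g" "\<forall>i\<in>{1..r}. g i \<le> L"
      "\<forall>k. dir_clique_number (T \<restriction> blk r g k) \<le> 2 * c"
      "\<forall>k<L. c \<le> dir_clique_number (T \<restriction> blk r g k)"
      using Suc.IH by auto
    define M where "M = (if c \<le> dir_clique_number (T \<restriction> blk r g L) then Suc L else L)"
    define g' where "g' = g(Suc r := M)"
    have other: "blk (Suc r) g' k = blk r g k" if "k \<noteq> M" for k
    proof -
      have "{i \<in> {1..Suc r}. g' i = k} = {i \<in> {1..r}. g i = k}"
        using that by (auto simp: g'_def le_Suc_eq)
      then show ?thesis by (simp add: blk_def)
    qed
    have last: "blk (Suc r) g' M = blk r g M \<union> Q (Suc r)"
    proof -
      have "{i \<in> {1..Suc r}. g' i = M} = insert (Suc r) {i \<in> {1..r}. g i = M}"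
        by (auto simp: g'_def le_Suc_eq)
      then show ?thesis by (auto simp: blk_def)
    qed
    have LM: "L \<le> M" by (simp add: M_def)
    have fin: "finite (blk r g k)" for k using Suc.prems by (auto simp: blk_def)
    have Q: "finite (Q (Suc r))" "dir_clique_number (T \<restriction> Q (Suc r)) \<le> c" using Suc.prems by auto
    \<comment> \<open>The new bag joins either block \<open>L\<close>, still below \<open>c\<close>,
      or block \<open>Suc L\<close>, so far empty.\<close>
    have small: "dir_clique_number (T \<restriction> blk r g M) \<le> c"
    proof (cases "M = L")
      case True
      then show ?thesis by (auto simp: M_def split: if_splits)
    next
      case False
      then have "M = Suc L" by (auto simp: M_def split: if_splits)
      then have "blk r g M = {}" using g(2) by (force simp: blk_def)
      then show ?thesis by (simp add: dir_clique_number_empty)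
    qed
    have "mono_on {1..Suc r} g'"
      using g(1,2) LM unfolding g'_def mono_on_def by (auto simp: le_Suc_eq intro: order_trans)
    moreover have "\<forall>i\<in>{1..Suc r}. g' i \<le> M"
      using g(2) LM by (auto simp: g'_def le_Suc_eq intro: order_trans)
    moreover have "dir_clique_number (T \<restriction> blk (Suc r) g' k) \<le> 2 * c" for k
    proof (cases "k = M")
      case True
      then show ?thesis
        using dir_clique_number_Un_le[OF fin[of M] Q(1), of T] small Q(2) last by simp
    qed (use other g(3) in simp)
    \<comment> \<open>Besides the blocks below \<open>L\<close>, only \<open>L\<close> itself can be
      newly completed. This happens when \<open>M = Suc L\<close>, and then the new bag leaves it
      unchanged.\<close>
    moreover have "c \<le> dir_clique_number (T \<restriction> blk (Suc r) g' k)" if "k < M" for k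
    proof (cases "k < L")
      case True
      then show ?thesis using other[of k] g(4) that by simp
    next
      case False
      then have "k = L" "c \<le> dir_clique_number (T \<restriction> blk r g L)"
        using that by (auto simp: M_def split: if_splits)
      then show ?thesis using other[of k] that by simp
    qed
    ultimately show ?case by blast
  qed
  then show thesis using that unfolding blk_def by blast
qed

section \<open>Bounding the clique number of the union of a near-bag-chain\<close>

theorem theorem6p7:
  fixes T :: "('a, 'b) pre_digraph"
    and m n c_small c a r :: nat
    and Q :: "nat \<Rightarrow> 'a set"
  assumes "m \<ge> 2" and "n \<ge> 2"
    and "tournament T"
    and "\<not> contains_copy T (A_tour m)"
    and "\<not> contains_copy T (D_tour n)"
    and "\<And>X. \<lbrakk>X \<subseteq> verts T; dir_clique_number (T \<restriction> X) \<ge> c_small\<rbrakk> \<Longrightarrow>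
           contains_copy (T \<restriction> X) (A_tour (m - 1)) \<and> contains_copy (T \<restriction> X) (D_tour (n - 1))"
    and "c \<ge> 2 * fact m * a + c_small"
    and "near_bag_chain T c a r Q"
  shows "dir_clique_number (T \<restriction> (\<Union>i \<in> {1..r}. Q i)) \<le> 4 * m * c"
proof -
  interpret tournament T by fact
  \<comment> \<open>\<open>k\<close> is the number of copies inside \<open>A_tour m\<close>, and
    \<open>Suc k\<close> the number of its further vertices.\<close>
  obtain k where m: "m = Suc k" using assms(1) by (cases m) auto
  have QV: "Q i \<subseteq> verts T" if "i \<in> {1..r}" for i
    using assms(8) that by (auto simp: near_bag_chain_def)
  have finQ: "finite (Q i)" if "i \<in> {1..r}" for i
    using QV[OF that] by (rule finite_subset) simp
  have Q_in: "dir_clique_number (T \<restriction> (in_nbhd T x \<inter> (\<Union>j \<in> {i<..r}. Q j))) \<le> a"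
    if "i \<in> {1..r}" "x \<in> Q i" for i x
    using assms(8) that by (auto simp: near_bag_chain_def)
  have Q_out: "dir_clique_number (T \<restriction> (out_nbhd T x \<inter> (\<Union>j \<in> {1..<i}. Q j))) \<le> a"
    if "i \<in> {1..r}" "x \<in> Q i" for i x
    using assms(8) that by (auto simp: near_bag_chain_def)
  have "\<And>i. i \<in> {1..r} \<Longrightarrow> finite (Q i) \<and> dir_clique_number (T \<restriction> Q i) \<le> c"
    using assms(8) finQ by (auto simp: near_bag_chain_def)
  then obtain g L where blocks: "mono_on {1..r} g" "\<forall>i\<in>{1..r}. g i \<le> (L :: nat)"
    "\<forall>k. dir_clique_number (T \<restriction> (\<Union>i\<in>{i \<in> {1..r}. g i = k}. Q i)) \<le> 2 * c"
    "\<forall>k<L. c \<le> dir_clique_number (T \<restriction> (\<Union>i\<in>{i \<in> {1..r}. g i = k}. Q i))"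
    by (rule exists_blocks)
  note g = blocks[rule_format]
  define U where "U = (\<Union>i \<in> {1..r}. Q i)"
  have UV: "U \<subseteq> verts T" unfolding U_def using QV by (rule UN_least)
  then have finU: "finite U" by (rule finite_subset) simp
  have "\<forall>x\<in>U. \<exists>i. i \<in> {1..r} \<and> x \<in> Q i" by (auto simp: U_def)
  then obtain idx where idx: "\<And>x. x \<in> U \<Longrightarrow> idx x \<in> {1..r} \<and> x \<in> Q (idx x)" by metis
  have idx_eq: "idx x = i" if "x \<in> Q i" "i \<in> {1..r}" for x i
  proof -
    have "x \<in> U" using that by (auto simp: U_def)
    moreover have "disjoint_family_on Q {1..r}" using assms(8) by (simp add: near_bag_chain_def)
    ultimately show ?thesis using idx[of x] that unfolding disjoint_family_on_def by blast
  qed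
  define h where "h x = g (idx x)" for x
  define P where "P k = {x \<in> U. h x = k}" for k
  have P_eq: "P k = (\<Union>i\<in>{i \<in> {1..r}. g i = k}. Q i)" for k
    using idx idx_eq unfolding P_def h_def by (fastforce simp: U_def)
  have PV: "P k \<subseteq> verts T" for k using UV by (auto simp: P_def)
  \<comment> \<open>Contrapositive of the monotonicity of \<open>g\<close>; it turns comparisons of
    blocks into comparisons of bags, to which the chain conditions apply.\<close>
  have mono: "idx x < idx y" if "x \<in> U" "y \<in> U" "h x < h y" for x y
  proof (rule ccontr)
    assume "\<not> idx x < idx y"
    then have "h y \<le> h x" using g(1) idx that(1,2) unfolding h_def mono_on_def by simp
    with that show False by simp
  qed
  have P_in: "dir_clique_number (T \<restriction> (in_nbhd T x \<inter> P l)) \<le> a" if "x \<in> U" "h x < l" for x l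
  proof -
    have "in_nbhd T x \<inter> P l \<subseteq> in_nbhd T x \<inter> (\<Union>j \<in> {idx x<..r}. Q j)"
      using mono[OF that(1)] that idx by (fastforce simp: P_def)
    moreover have "finite (in_nbhd T x \<inter> (\<Union>j \<in> {idx x<..r}. Q j))" using finQ by auto
    ultimately show ?thesis
      using Q_in[of "idx x" x] idx[OF that(1)] dir_clique_number_mono order_trans by blast
  qed
  have P_out: "dir_clique_number (T \<restriction> (out_nbhd T x \<inter> P l)) \<le> a" if "x \<in> U" "l < h x" for x l
  proof -
    have "out_nbhd T x \<inter> P l \<subseteq> out_nbhd T x \<inter> (\<Union>j \<in> {1..<idx x}. Q j)"
      using mono[OF _ that(1)] that idx by (fastforce simp: P_def)
    moreover have "finite (out_nbhd T x \<inter> (\<Union>j \<in> {1..<idx x}. Q j))"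
      using finQ idx[OF that(1)] by auto
    ultimately show ?thesis
      using Q_out[of "idx x" x] idx[OF that(1)] dir_clique_number_mono order_trans by blast
  qed
  have "dir_clique_number (T \<restriction> {x \<in> U. h x = i}) \<le> 2 * c" for i
    using g(3) P_eq unfolding P_def by simp
  then obtain R where R: "linear_order_on U (lex_rel U h R)"
    "\<And>K i. K \<subseteq> U \<Longrightarrow> back_clique T (lex_rel U h R) K \<Longrightarrow> card {x \<in> K. h x = i} \<le> 2 * c"
    using exists_lex_rel[OF finU, of T h "\<lambda>_. 2 * c"] by blast
  \<comment> \<open>Otherwise at least \<open>2 * k + 1\<close> blocks are met: enough for
    \<open>Suc k\<close> clique vertices with \<open>k\<close> host blocks between them.\<close>
  have few: "card (h ` K) \<le> 2 * k" if K: "K \<subseteq> U" "back_clique T (lex_rel U h R) K" for K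
  proof (rule ccontr)
    assume "\<not> card (h ` K) \<le> 2 * k"
    define s where "s = sorted_list_of_set (h ` K)"
    have finK: "finite K" using K finU finite_subset by blast
    then have s: "set s = h ` K" "length s > 2 * k" "sorted_wrt (<) s"
      using \<open>\<not> card (h ` K) \<le> 2 * k\<close> by (auto simp: s_def)
    have s_less: "s ! i < s ! j" if "i < j" "j \<le> 2 * k" for i j
      using sorted_wrt_nth_less[OF s(3), of i j] that s(2) by simp
    have "\<forall>i. \<exists>x. i \<le> 2 * k \<longrightarrow> x \<in> K \<and> h x = s ! i"
    proof
      fix i
      show "\<exists>x. i \<le> 2 * k \<longrightarrow> x \<in> K \<and> h x = s ! i"
      proof (cases "i \<le> 2 * k")
        case True
        then have "s ! i \<in> h ` K" using s(1,2) by (metis le_less_trans nth_mem)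
        then show ?thesis by auto
      qed auto
    qed
    then obtain w where w: "\<And>i. i \<le> 2 * k \<Longrightarrow> w i \<in> K \<and> h (w i) = s ! i" by metis
    \<comment> \<open>Values at even positions of \<open>s\<close> carry the vertices \<open>v i\<close>, those at odd positions are the
      blocks that host the copies.\<close>
    define v where "v i = w (2 * (i - 1))" for i
    define W where "W j = P (s ! (2 * j - 1))" for j
    have v: "v i \<in> K" "v i \<in> U" "h (v i) = s ! (2 * (i - 1))" if "i \<in> {1..Suc k}" for i
      using w[of "2 * (i - 1)"] that K(1) by (auto simp: v_def)
    \<comment> \<open>Position \<open>2 * j - 1\<close> lies strictly between the positions
      \<open>2 * (j - 1)\<close> of \<open>v j\<close> and \<open>2 * j\<close> of
      \<open>v (Suc j)\<close>. The subtractions are exact since indices start at 1.\<close>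
    have lt: "h (v i) < s ! (2 * j - 1)" if "i \<in> {1..Suc k}" "j \<in> {1..k}" "i \<le> j" for i j
      using that s_less[of "2 * (i - 1)" "2 * j - 1"] v by auto
    have gt: "s ! (2 * j - 1) < h (v i)" if "i \<in> {1..Suc k}" "j \<in> {1..k}" "j < i" for i j
      using that s_less[of "2 * j - 1" "2 * (i - 1)"] v by auto
    have "contains_copy T (A_tour (Suc k))"
    proof (rule contains_A_tour_Suc[where v = v and W = W and a = a and s = c_small])
      show "v i \<in> verts T" if "i \<in> {1..Suc k}" for i using v[OF that] UV by auto
      show "v j \<rightarrow>\<^bsub>T\<^esub> v i" if "i \<in> {1..Suc k}" "j \<in> {1..Suc k}" "i < j" for i j
      proof -
        \<comment> \<open>A later block means later in the order, so the clique property makes the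
          arc point backwards.\<close>
        have "h (v i) < h (v j)"
          using that v s_less[of "2 * (i - 1)" "2 * (j - 1)"] by auto
        then have "(v i, v j) \<in> lex_rel U h R" "v i \<noteq> v j"
          using v(2)[OF that(1)] v(2)[OF that(2)] by (auto simp: lex_rel_def)
        then show ?thesis using K(2) v that unfolding back_clique_def by blast
      qed
      show "W j \<subseteq> verts T" if "j \<in> {1..k}" for j using PV by (simp add: W_def)
      show "dir_clique_number (T \<restriction> (in_nbhd T (v i) \<inter> W j)) \<le> a \<and> v i \<notin> W j"
        if "i \<in> {1..Suc k}" "j \<in> {1..k}" "i \<le> j" for i j
        using P_in[OF v(2) lt] lt[OF that] that by (auto simp: W_def P_def)
      show "dir_clique_number (T \<restriction> (out_nbhd T (v i) \<inter> W j)) \<le> a \<and> v i \<notin> W j"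
        if "i \<in> {1..Suc k}" "j \<in> {1..k}" "j < i" for i j
        using P_out[OF v(2) gt] gt[OF that] that by (auto simp: W_def P_def)
      show "dir_clique_number (T \<restriction> (in_nbhd T x \<inter> W j)) \<le> a \<and> x \<notin> W j"
        if "i \<in> {1..k}" "j \<in> {1..k}" "i < j" "x \<in> W i" for i j x
      proof -
        have "s ! (2 * i - 1) < s ! (2 * j - 1)" using that s_less by auto
        moreover have "x \<in> U" "h x = s ! (2 * i - 1)" using that by (auto simp: W_def P_def)
        ultimately show ?thesis using P_in[of x "s ! (2 * j - 1)"] by (auto simp: W_def P_def)
      qed
      show "2 * fact (Suc k) * a + c_small \<le> dir_clique_number (T \<restriction> W j)" if "j \<in> {1..k}" for j
      proof -
        \<comment> \<open>A host block is followed by the block of \<open>v (Suc j)\<close>. It is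
          therefore not the last block \<open>L\<close>, the only one that may have clique number
          below \<open>c\<close>.\<close>
        have "s ! (2 * j - 1) < h (v (Suc j))" using gt[of "Suc j" j] that by auto
        also have "\<dots> \<le> L" using v(2)[of "Suc j"] that g(2) idx by (auto simp: h_def)
        finally have "c \<le> dir_clique_number (T \<restriction> W j)" using g(4) P_eq by (simp add: W_def)
        then show ?thesis using assms(7) m by simp
      qed
      show "contains_copy (T \<restriction> X) (A_tour k)"
        if "X \<subseteq> verts T" "c_small \<le> dir_clique_number (T \<restriction> X)" for X
        using assms(6)[OF that] m by simp
    qed
    then show False using assms(4) m by simp
  qed
  have "card K \<le> 4 * m * c" if K: "K \<subseteq> U" "back_clique T (lex_rel U h R) K" for K
  proof -
    have finK: "finite K" using K finU finite_subset by blast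
    \<comment> \<open>Split the clique by blocks: at most \<open>2 * k\<close> of them, each
      contributing at most \<open>2 * c\<close> vertices.\<close>
    have "card K = card (\<Union>i\<in>h ` K. {x \<in> K. h x = i})" by (rule arg_cong[of _ _ card]) auto
    also have "\<dots> \<le> (\<Sum>i\<in>h ` K. card {x \<in> K. h x = i})"
      using finK by (intro card_UN_le) simp
    also have "\<dots> \<le> card (h ` K) * (2 * c)"
      using sum_bounded_above[of "h ` K" "\<lambda>i. card {x \<in> K. h x = i}" "2 * c"] R(2)[OF K] by simp
    also have "\<dots> \<le> (2 * k) * (2 * c)" using few[OF K] by (intro mult_right_mono) auto
    also have "\<dots> \<le> 4 * m * c" using m by simp
    finally show ?thesis .
  qed
  then show ?thesis
    using R(1) finU unfolding U_def[symmetric] by (subst dir_clique_number_le_iff) auto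
qed

end
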